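(* For every $\varepsilon>0$, $$\sup_{F}\ \limsup_{n\to\infty}\frac{\Delta_n(F,\dots,F)}{\sup_{0<z\le\varepsilon}zL_n(z)}=\infty,$$ where the supremum is over all distribution functions $F$ on $\mathbb R$ with zero mean, finite second moment and positive variance, and $\Delta_n$, $L_n$ are computed for $n$ i.i.d. summands with d.f. $F$.
   Context: For i.i.d. real random variables $X_1,\dots,X_n$ with d.f. $F$, $\mathbb E X_1=0$, $0<\sigma^2=\mathbb E X_1^2<\infty$: $B_n^2=n\sigma^2$, $S_n=\sum_kX_k$, $\Delta_n(F,\dots,F)=\sup_x|\mathbb P(S_n<xB_n)-\Phi(x)|$ with $\Phi$ the standard normal d.f., and $L_n(z)=B_n^{-2}\sum_{k=1}^n\mathbb E X_k^2\mathbf 1(|X_k|\ge zB_n)$ for $z\ge0$. *)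

theory Defs
  imports "HOL-Probability.Probability"
begin

definition Phi :: "real \<Rightarrow> real" where
  "Phi x = measure (density lborel std_normal_density) {..<x}"

definition admissible_dist :: "real measure \<Rightarrow> bool" where
  "admissible_dist M \<longleftrightarrow> prob_space M \<and> sets M = sets borel \<and>
     integrable M (\<lambda>x. x) \<and> integrable M (\<lambda>x. x\<^sup>2) \<and>
     integral\<^sup>L M (\<lambda>x. x) = 0 \<and> integral\<^sup>L M (\<lambda>x. x\<^sup>2) > 0"

definition sigma2 :: "real measure \<Rightarrow> real" where
  "sigma2 M = integral\<^sup>L M (\<lambda>x. x\<^sup>2)"

definition Bn :: "nat \<Rightarrow> real measure \<Rightarrow> real" where
  "Bn n M = sqrt (real n * sigma2 M)"

definition Delta :: "nat \<Rightarrow> real measure \<Rightarrow> real" where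
  "Delta n M = (SUP x. \<bar>measure (PiM {..<n} (\<lambda>_. M))
       {\<omega> \<in> space (PiM {..<n} (\<lambda>_. M)). (\<Sum>i<n. \<omega> i) < x * Bn n M} - Phi x\<bar>)"

definition Lind :: "nat \<Rightarrow> real measure \<Rightarrow> real \<Rightarrow> real" where
  "Lind n M z = (\<Sum>k<n. integral\<^sup>L M (\<lambda>x. x\<^sup>2 * indicator {x. \<bar>x\<bar> \<ge> z * Bn n M} x)) / (Bn n M)\<^sup>2"

end

theory Submission
  imports Defs "HOL-Real_Asymp.Real_Asymp"
begin

text \<open>
  For a law with finite third moment, \<open>sqrt n * sup\<^sub>z z L\<^sub>n(z)\<close> is at most the weak third moment
  \<open>sup\<^sub>t t E[X\<^sup>2; \<bar>X\<bar> \<ge> t]\<close> divided by \<open>\<sigma>\<^sup>3\<close>, whereas \<open>sqrt n * \<Delta>\<^sub>n\<close> is asymptotically at least a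
  universal constant times \<open>E X\<^sup>3 / \<sigma>\<^sup>3\<close>. A one-sided tail of order \<open>x\<^sup>-\<^sup>3\<close>, cut off at \<open>2\<^sup>N\<close>, keeps the
  weak third moment bounded while \<open>E X\<^sup>3\<close> grows like \<open>N\<close>.

  The lower bound on \<open>\<Delta>\<^sub>n\<close> comes from the test function \<open>h x = x exp (- x\<^sup>2 / 2)\<close>. It has bounded
  variation, so \<open>\<bar>E h(W) - E h(Z)\<bar>\<close> is at most a constant times the Kolmogorov distance of \<open>W\<close> from
  a standard normal \<open>Z\<close>, and \<open>E h(Z) = 0\<close>. On the other hand \<open>h x = E[Y sin (x Y)]\<close> for a standard
  normal \<open>Y\<close>, so \<open>E h(W) = E[Y Im (char W Y)]\<close>, which for normalized sums is governed by the third
  moment.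
\<close>

section \<open>Integration over unbounded intervals and Gaussian integrals\<close>

lemma integral_greaterThan_FTC:
  fixes f F :: "real \<Rightarrow> real"
  assumes F: "\<And>x. (F has_real_derivative f x) (at x)"
    and f: "continuous_on UNIV f" "integrable lborel f"
    and lim: "(F \<longlongrightarrow> 0) at_top"
  shows "(LINT y|lborel. indicator {x<..} y * f y) = - F x"
proof -
  have cont: "isCont f y" for y
    using f(1) by (simp add: continuous_on_eq_continuous_at)
  have "(LBINT y=ereal x..\<infinity>. f y) = 0 - F x"
  proof (rule interval_integral_FTC_integrable)
    show "set_integrable lborel (einterval (ereal x) \<infinity>) f"
      unfolding set_integrable_def using f(2) by (intro integrable_mult_indicator) auto
    show "((F \<circ> real_of_ereal) \<longlongrightarrow> F x) (at_right (ereal x))"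
      using DERIV_isCont[OF F, of x]
      by (auto simp: ereal_tendsto_simps isCont_def intro: tendsto_within_subset)
    show "((F \<circ> real_of_ereal) \<longlongrightarrow> 0) (at_left \<infinity>)"
      using lim by (simp add: ereal_tendsto_simps)
  qed (use F cont in \<open>auto simp: has_real_derivative_iff_has_vector_derivative\<close>)
  then show ?thesis
    by (simp add: interval_lebesgue_integral_def set_lebesgue_integral_def)
qed

lemma integral_UNIV_FTC_eq_0:
  fixes f F :: "real \<Rightarrow> real"
  assumes F: "\<And>x. (F has_real_derivative f x) (at x)"
    and f: "continuous_on UNIV f" "integrable lborel f"
    and lim: "(F \<longlongrightarrow> 0) at_top" "(F \<longlongrightarrow> 0) at_bot"
  shows "(LINT y|lborel. f y) = 0"
proof -
  have cont: "isCont f y" for y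
    using f(1) by (simp add: continuous_on_eq_continuous_at)
  have "(LBINT y=-\<infinity>..\<infinity>. f y) = 0 - 0"
  proof (rule interval_integral_FTC_integrable)
    show "set_integrable lborel (einterval (-\<infinity>) \<infinity>) f"
      unfolding set_integrable_def using f(2) by (intro integrable_mult_indicator) auto
    show "((F \<circ> real_of_ereal) \<longlongrightarrow> 0) (at_right (-\<infinity>))"
      using lim by (simp add: ereal_tendsto_simps)
    show "((F \<circ> real_of_ereal) \<longlongrightarrow> 0) (at_left \<infinity>)"
      using lim by (simp add: ereal_tendsto_simps)
  qed (use F cont in \<open>auto simp: has_real_derivative_iff_has_vector_derivative\<close>)
  then show ?thesis
    by (simp add: interval_lebesgue_integral_def set_lebesgue_integral_def)
qed

lemma DERIV_std_normal_density:
  "(std_normal_density has_real_derivative - x * std_normal_density x) (at x)"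
  unfolding std_normal_density_def
  by (rule derivative_eq_intros refl | simp)+

lemma std_normal_density_tendsto_0:
  "(std_normal_density \<longlongrightarrow> 0) at_top" "(std_normal_density \<longlongrightarrow> 0) at_bot"
  unfolding std_normal_density_def by real_asymp+

lemma continuous_on_std_normal_density [continuous_intros]:
  "continuous_on A std_normal_density"
  unfolding std_normal_density_def by (intro continuous_intros) auto

text \<open>Integrate the derivative of \<open>std_normal_density y * sin (x * y)\<close> over the line.\<close>

lemma std_normal_integral_mult_sin:
  "(LINT y|std_normal_distribution. y * sin (x * y)) = x * exp (- x\<^sup>2 / 2)"
proof -
  interpret real_distribution std_normal_distribution
    by (rule real_dist_normal_dist)
  let ?n = std_normal_density
  have i1: "integrable std_normal_distribution (\<lambda>y. y * sin (x * y))"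
    using integrable_std_normal_distribution_moment[of 1]
    by (rule Bochner_Integration.integrable_bound) (auto simp: abs_mult intro!: mult_left_le)
  have i2: "integrable std_normal_distribution (\<lambda>y. cos (x * y))"
    by (rule integrable_const_bound[where B = 1]) auto
  have c: "(LINT y|std_normal_distribution. cos (x * y)) = exp (- x\<^sup>2 / 2)"
  proof -
    have "(LINT y|std_normal_distribution. cos (x * y)) = Re (char std_normal_distribution x)"
      unfolding char_def by (subst integral_Re[symmetric]) (auto intro!: integrable_iexp simp: Re_exp)
    then show ?thesis
      by (simp add: char_std_normal_distribution)
  qed
  have j1: "integrable lborel (\<lambda>y. ?n y * (y * sin (x * y)))"
    using i1 by (subst (asm) integrable_density) auto
  have j2: "integrable lborel (\<lambda>y. ?n y * cos (x * y))"
    using i2 by (subst (asm) integrable_density) auto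
  have lim: "((\<lambda>y. ?n y * sin (x * y)) \<longlongrightarrow> 0) F" if "(?n \<longlongrightarrow> 0) F" for F
  proof (rule Lim_null_comparison[OF _ that])
    show "\<forall>\<^sub>F y in F. norm (?n y * sin (x * y)) \<le> ?n y"
      by (intro always_eventually allI) (auto simp: abs_mult intro!: mult_left_le)
  qed
  have "(LINT y|lborel. x * (?n y * cos (x * y)) - ?n y * (y * sin (x * y))) = 0"
  proof (rule integral_UNIV_FTC_eq_0[where F = "\<lambda>y. ?n y * sin (x * y)"])
    show "((\<lambda>y. ?n y * sin (x * y)) has_real_derivative
        x * (?n y * cos (x * y)) - ?n y * (y * sin (x * y))) (at y)" for y
      by (auto intro!: derivative_eq_intros DERIV_std_normal_density simp: algebra_simps)
    show "continuous_on UNIV (\<lambda>y. x * (?n y * cos (x * y)) - ?n y * (y * sin (x * y)))"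
      by (intro continuous_intros)
    show "integrable lborel (\<lambda>y. x * (?n y * cos (x * y)) - ?n y * (y * sin (x * y)))"
      using j1 j2 by auto
  qed (use lim std_normal_density_tendsto_0 in auto)
  then have "x * (LINT y|lborel. ?n y * cos (x * y)) = (LINT y|lborel. ?n y * (y * sin (x * y)))"
    using j1 j2 by simp
  then show ?thesis
    using c by (simp add: integral_density)
qed

section \<open>Expectation of the test function through characteristic functions and through
  distribution functions\<close>

text \<open>\<open>Im (char M t)\<close> is the mean of \<open>sin (t * x)\<close>, and
  \<open>\<bar>t\<bar>\<close> dominates the integrand, so Fubini applies and the inner integral is
  \<open>std_normal_integral_mult_sin\<close>. The test function is thereby seen through
  characteristic functions, which factor over independent sums.\<close>

lemma (in real_distribution) integral_Im_char_std_normal: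
  "(LINT t|std_normal_distribution. t * Im (char M t)) = (LINT x|M. x * exp (- x\<^sup>2 / 2))"
proof -
  interpret N: real_distribution std_normal_distribution
    by (rule real_dist_normal_dist)
  interpret P: pair_sigma_finite M std_normal_distribution ..
  have Im: "Im (char M t) = (LINT x|M. sin (t * x))" for t
    unfolding char_def by (subst integral_Im[symmetric]) (auto intro!: integrable_iexp simp: Im_exp)
  have int1: "integrable std_normal_distribution (\<lambda>t. t * sin (t * x))" for x
    using integrable_std_normal_distribution_moment[of 1]
    by (rule Bochner_Integration.integrable_bound) (auto simp: abs_mult intro!: mult_left_le)
  have int: "integrable (M \<Otimes>\<^sub>M std_normal_distribution) (\<lambda>(x, t). t * sin (t * x))"
  proof (rule P.Fubini_integrable)
    have "(LINT t|std_normal_distribution. norm (t * sin (t * x)))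
        \<le> (LINT t|std_normal_distribution. norm t)" for x
    proof (rule integral_mono)
      show "integrable std_normal_distribution (\<lambda>t. norm (t * sin (t * x)))"
        by (rule integrable_norm[OF int1])
      show "integrable std_normal_distribution (\<lambda>t::real. norm t)"
        using integrable_norm[OF integrable_std_normal_distribution_moment[of 1]] by simp
    qed (simp add: abs_mult mult_left_le)
    moreover have "(LINT t|std_normal_distribution. norm (t * sin (t * x))) \<ge> 0" for x
      by (rule Bochner_Integration.integral_nonneg) simp
    ultimately have "norm (LINT t|std_normal_distribution. norm (t * sin (t * x)))
        \<le> (LINT t|std_normal_distribution. norm t)" for x
      by (simp only: real_norm_def abs_of_nonneg)
    then show "integrable M (\<lambda>x. LINT y|std_normal_distribution. norm (case (x, y) of (x, t) \<Rightarrow> t * sin (t * x)))"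
      by (intro integrable_const_bound[where B = "LINT t|std_normal_distribution. norm t"]) auto
  qed (use int1 in auto)
  have "(LINT t|std_normal_distribution. t * Im (char M t))
      = (LINT t|std_normal_distribution. (LINT x|M. t * sin (t * x)))"
    by (simp add: Im)
  also have "\<dots> = (LINT x|M. (LINT t|std_normal_distribution. t * sin (t * x)))"
    using int by (rule P.Fubini_integral)
  also have "\<dots> = (LINT x|M. x * exp (- x\<^sup>2 / 2))"
    using std_normal_integral_mult_sin by (simp add: mult.commute)
  finally show ?thesis .
qed

text \<open>The function \<open>y * std_normal_density y\<close> has derivative
  \<open>(1 - y\<^sup>2) * std_normal_density y\<close> and vanishes at infinity, so its value at
  \<open>x\<close> is minus the integral of that derivative over \<open>{x<..}\<close>. Fubini then
  turns the indicator of \<open>x < y\<close> into \<open>measure M {..<y}\<close>. The open ray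
  matches the strict inequality in \<open>Phi\<close> and \<open>Delta\<close>.\<close>

lemma (in real_distribution) integral_std_normal_density_cdf:
  "(LINT x|M. x * std_normal_density x)
     = - (LINT y|lborel. (1 - y\<^sup>2) * std_normal_density y * measure M {..<y})"
proof -
  interpret P: pair_sigma_finite M lborel ..
  let ?n = std_normal_density
  let ?h = "\<lambda>y. (1 - y\<^sup>2) * ?n y"
  have h: "integrable lborel ?h"
    using integrable_std_normal_moment[of 0] integrable_std_normal_moment[of 2]
    by (simp add: algebra_simps)
  have FTC: "(LINT y|lborel. indicator {x<..} y * ?h y) = - (x * ?n x)" for x
  proof (rule integral_greaterThan_FTC[where F = "\<lambda>y. y * ?n y"])
    show "((\<lambda>y. y * ?n y) has_real_derivative ?h y) (at y)" for y
      by (auto intro!: derivative_eq_intros DERIV_std_normal_density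
          simp: algebra_simps power2_eq_square)
    show "continuous_on UNIV ?h"
      by (intro continuous_intros)
    show "((\<lambda>y. y * ?n y) \<longlongrightarrow> 0) at_top"
      unfolding std_normal_density_def by real_asymp
  qed (use h in auto)
  have [measurable]: "{p \<in> space (M \<Otimes>\<^sub>M lborel). fst p < snd p} \<in> sets (M \<Otimes>\<^sub>M lborel)"
    by measurable
  have int1: "integrable lborel (\<lambda>y. indicator {x<..} y * ?h y)" for x
    using integrable_mult_indicator[OF _ h, of "{x<..}"] by simp
  have int: "integrable (M \<Otimes>\<^sub>M lborel) (\<lambda>(x, y). indicator {x<..} y * ?h y)"
  proof (rule P.Fubini_integrable)
    \<comment> \<open>Written as a condition on \<open>fst p < snd p\<close>, the indicator with
      moving endpoint is jointly measurable.\<close>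
    have eq: "(\<lambda>(x, y). indicator {x<..} y * ?h y) = (\<lambda>p. if fst p < snd p then ?h (snd p) else 0)"
      by (auto simp: fun_eq_iff indicator_def)
    show "(\<lambda>(x, y). indicator {x<..} y * ?h y) \<in> borel_measurable (M \<Otimes>\<^sub>M lborel)"
      unfolding eq by measurable
    have "norm (LINT y|lborel. norm (indicator {x<..} y * ?h y)) \<le> (LINT y|lborel. norm (?h y))" for x
      using int1[of x] h
      by (subst real_norm_def, subst abs_of_nonneg)
        (auto intro!: integral_mono simp: indicator_def simp del: real_norm_def)
    moreover have "(\<lambda>x. LINT y|lborel. norm (case (x, y) of (x, y) \<Rightarrow> indicator {x<..} y * ?h y))
       \<in> borel_measurable M"
    proof (rule lborel.borel_measurable_lebesgue_integral)
      have eq: "(\<lambda>(x, y). norm (case (x, y) of (x, y) \<Rightarrow> indicator {x<..} y * ?h y))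
          = (\<lambda>p. if fst p < snd p then norm (?h (snd p)) else 0)"
        by (auto simp: fun_eq_iff indicator_def)
      show "(\<lambda>(x, y). norm (case (x, y) of (x, y) \<Rightarrow> indicator {x<..} y * ?h y))
          \<in> borel_measurable (M \<Otimes>\<^sub>M lborel)"
        unfolding eq by measurable
    qed
    ultimately show "integrable M (\<lambda>x. LINT y|lborel. norm (case (x, y) of (x, y) \<Rightarrow> indicator {x<..} y * ?h y))"
      by (intro integrable_const_bound[where B = "LINT y|lborel. norm (?h y)"]) auto
  qed (use int1 in auto)
  have "- (LINT x|M. x * ?n x) = (LINT x|M. (LINT y|lborel. indicator {x<..} y * ?h y))"
    by (simp add: FTC)
  also have "\<dots> = (LINT y|lborel. (LINT x|M. indicator {x<..} y * ?h y))"
    using P.Fubini_integral[OF int] by simp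
  also have "\<dots> = (LINT y|lborel. ?h y * measure M {..<y})"
  proof (intro Bochner_Integration.integral_cong refl)
    fix y
    have "(LINT x|M. indicator {x<..} y * ?h y) = (LINT x|M. ?h y * indicator {..<y} x)"
      by (intro Bochner_Integration.integral_cong) (auto simp: indicator_def)
    then show "(LINT x|M. indicator {x<..} y * ?h y) = ?h y * measure M {..<y}"
      by simp
  qed
  finally show ?thesis by simp
qed

text \<open>By \<open>integral_std_normal_density_cdf\<close>, passing from \<open>M\<close> to the
  Gaussian changes the expectation by the integral of a fixed integrable function against a
  difference of distribution functions, which is at most \<open>D\<close>. The quantifier order
  matters: \<open>C\<close> comes before \<open>M\<close>, hence serves all laws and all
  \<open>n\<close> at once.\<close>

lemma integral_Im_char_le_Kolmogorov_distance:
  "\<exists>C>0. \<forall>M D. real_distribution M \<longrightarrow> (\<forall>x. \<bar>measure M {..<x} - Phi x\<bar> \<le> D) \<longrightarrow>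
     \<bar>LINT t|std_normal_distribution. t * Im (char M t)\<bar> \<le> C * D"
proof -
  let ?n = std_normal_density
  let ?h = "\<lambda>y. (1 - y\<^sup>2) * ?n y"
  define V where "V = (LINT y|lborel. \<bar>?h y\<bar>)"
  \<comment> \<open>The factor \<open>sqrt (2 * pi)\<close> passes from
    \<open>std_normal_density\<close> to \<open>exp (- x\<^sup>2 / 2)\<close>; adding 1 gives
    \<open>C > 0\<close> from \<open>V \<ge> 0\<close> alone.\<close>
  define C where "C = sqrt (2 * pi) * V + 1"
  have h: "integrable lborel ?h"
    using integrable_std_normal_moment[of 0] integrable_std_normal_moment[of 2]
    by (simp add: algebra_simps)
  have "V \<ge> 0"
    unfolding V_def by simp
  then have "C > 0"
    unfolding C_def by (simp add: add_nonneg_pos)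
  moreover have "\<bar>LINT t|std_normal_distribution. t * Im (char M t)\<bar> \<le> C * D"
    if M: "real_distribution M" and D: "\<And>x. \<bar>measure M {..<x} - Phi x\<bar> \<le> D" for M D
  proof -
    interpret real_distribution M by fact
    interpret N: real_distribution std_normal_distribution
      by (rule real_dist_normal_dist)
    have "D \<ge> 0"
      using D[of 0] by linarith
    have cdf_int: "integrable lborel (\<lambda>y. ?h y * measure K {..<y})" if "real_distribution K" for K
    proof -
      interpret K: real_distribution K by fact
      have "mono (\<lambda>y. measure K {..<y})"
        by (intro monoI K.finite_measure_mono) auto
      then have [measurable]: "(\<lambda>y. measure K {..<y}) \<in> borel_measurable borel"
        by (rule borel_measurable_mono)
      show ?thesis
        using h by (rule Bochner_Integration.integrable_bound) (auto simp: abs_mult intro!: mult_left_le)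
    qed
    \<comment> \<open>The Gaussian characteristic function is real, so the Gaussian expectation of
      the test function is zero and may be subtracted below.\<close>
    have "(LINT x|std_normal_distribution. x * exp (- x\<^sup>2 / 2)) = 0"
      unfolding N.integral_Im_char_std_normal[symmetric] by (simp add: char_std_normal_distribution)
    then have N0: "(LINT x|std_normal_distribution. x * ?n x) = 0"
      by (simp add: std_normal_density_def)
    have "(LINT t|std_normal_distribution. t * Im (char M t)) = sqrt (2 * pi) * (LINT x|M. x * ?n x)"
    proof -
      have "(LINT x|M. x * exp (- x\<^sup>2 / 2)) = (LINT x|M. sqrt (2 * pi) * (x * ?n x))"
        by (intro Bochner_Integration.integral_cong) (auto simp: std_normal_density_def)
      then show ?thesis
        unfolding integral_Im_char_std_normal by simp
    qed
    moreover have "\<bar>LINT x|M. x * ?n x\<bar> \<le> V * D"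
    proof -
      have "(LINT x|M. x * ?n x) = (LINT x|M. x * ?n x) - (LINT x|std_normal_distribution. x * ?n x)"
        using N0 by simp
      also have "\<dots> = (LINT y|lborel. ?h y * Phi y) - (LINT y|lborel. ?h y * measure M {..<y})"
        unfolding integral_std_normal_density_cdf N.integral_std_normal_density_cdf Phi_def by simp
      also have "\<dots> = (LINT y|lborel. ?h y * Phi y - ?h y * measure M {..<y})"
        using cdf_int[OF M] cdf_int[OF real_dist_normal_dist]
        by (subst Bochner_Integration.integral_diff) (auto simp: Phi_def)
      finally have eq: "(LINT x|M. x * ?n x) = (LINT y|lborel. ?h y * Phi y - ?h y * measure M {..<y})" .
      have "norm (LINT y|lborel. ?h y * Phi y - ?h y * measure M {..<y}) \<le> (LINT y|lborel. \<bar>?h y\<bar> * D)"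
      proof (rule Bochner_Integration.integral_norm_bound_integral)
        show "integrable lborel (\<lambda>y. ?h y * Phi y - ?h y * measure M {..<y})"
          using cdf_int[OF M] cdf_int[OF real_dist_normal_dist] by (auto simp: Phi_def)
        show "norm (?h y * Phi y - ?h y * measure M {..<y}) \<le> \<bar>?h y\<bar> * D" for y
        proof -
          have "?h y * Phi y - ?h y * measure M {..<y} = ?h y * (Phi y - measure M {..<y})"
            by (simp add: algebra_simps)
          then show ?thesis
            using D[of y] by (simp only: real_norm_def abs_mult) (auto intro!: mult_left_mono)
        qed
      qed (use h in auto)
      then show ?thesis
        unfolding eq V_def using h by simp
    qed
    ultimately have "\<bar>LINT t|std_normal_distribution. t * Im (char M t)\<bar> \<le> sqrt (2 * pi) * (V * D)"
      by (simp add: abs_mult)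
    also have "\<dots> \<le> C * D"
      using \<open>D \<ge> 0\<close> by (simp add: C_def algebra_simps)
    finally show ?thesis .
  qed
  ultimately show ?thesis by blast
qed

section \<open>Taylor estimates for powers, the sine and characteristic functions\<close>

text \<open>Passing to the next exponent multiplies the remainder by \<open>a\<close> and adds
  \<open>of_nat (Suc n) * b ^ n * (a - b)\<^sup>2\<close>, so the coefficients add up to at most
  \<open>(Suc n)\<^sup>2\<close>. The plain bound on \<open>a ^ n - b ^ n\<close> would lose the
  exact linear term, which carries the third moment.\<close>

lemma norm_power_second_order_le:
  fixes a b :: "'a :: {real_normed_field}"
  assumes "norm a \<le> 1" "norm b \<le> 1"
  shows "norm (a ^ Suc n - b ^ Suc n - of_nat (Suc n) * b ^ n * (a - b)) \<le> (real (Suc n))\<^sup>2 * (norm (a - b))\<^sup>2"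
proof (induction n)
  case (Suc n)
  have "a ^ Suc (Suc n) - b ^ Suc (Suc n) - of_nat (Suc (Suc n)) * b ^ Suc n * (a - b)
      = a * (a ^ Suc n - b ^ Suc n - of_nat (Suc n) * b ^ n * (a - b)) + of_nat (Suc n) * b ^ n * (a - b)\<^sup>2"
    by (simp add: algebra_simps power2_eq_square)
  also have "norm \<dots> \<le> 1 * ((real (Suc n))\<^sup>2 * (norm (a - b))\<^sup>2) + real (Suc n) * 1 * (norm (a - b))\<^sup>2"
  proof (intro norm_triangle_le add_mono)
    show "norm (a * (a ^ Suc n - b ^ Suc n - of_nat (Suc n) * b ^ n * (a - b)))
        \<le> 1 * ((real (Suc n))\<^sup>2 * (norm (a - b))\<^sup>2)"
      unfolding norm_mult[of a] by (intro mult_mono assms Suc) auto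
    show "norm (of_nat (Suc n) * b ^ n * (a - b)\<^sup>2) \<le> real (Suc n) * 1 * (norm (a - b))\<^sup>2"
      unfolding norm_mult norm_power norm_of_nat
      by (intro mult_mono power_le_one assms) auto
  qed
  also have "\<dots> \<le> (real (Suc (Suc n)))\<^sup>2 * (norm (a - b))\<^sup>2"
    by (simp add: algebra_simps power2_eq_square)
  finally show ?case .
qed simp

text \<open>The sine has no quadratic term, so expanding to order three leaves only the cubic error;
  oddness handles negative \<open>u\<close>. This supplies the majorant in
  \<open>Im_char_limit\<close>.\<close>

lemma abs_sin_diff_le: "\<bar>sin u - u\<bar> \<le> \<bar>u\<bar> ^ 3 / 6" for u :: real
proof -
  have *: "\<bar>sin u - u\<bar> \<le> u ^ 3 / 6" if "u \<ge> 0" for u :: real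
  proof -
    have "\<bar>sin u - (\<Sum>m<3. sin_coeff m * u ^ m)\<bar> \<le> inverse (fact 3) * \<bar>u\<bar> ^ 3"
      by (rule Maclaurin_sin_bound)
    then show ?thesis
      using that by (simp add: sin_coeff_def numeral_3_eq_3 eval_nat_numeral)
  qed
  show ?thesis
    using *[of u] *[of "- u"] by (cases "u \<ge> 0") auto
qed

text \<open>The Gaussian satisfies the same third-order bound, so both characteristic functions are compared
  with their common quadratic Taylor polynomial.\<close>

lemma (in real_distribution) char_diff_normal_le:
  assumes int: "integrable M (\<lambda>x. x)" "integrable M (\<lambda>x. x\<^sup>2)" "integrable M (\<lambda>x. \<bar>x\<bar> ^ 3)"
    and mean: "expectation (\<lambda>x. x) = 0"
    and var: "expectation (\<lambda>x. x\<^sup>2) = \<sigma>\<^sup>2" and "\<sigma> \<ge> 0"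
  shows "norm (char M s - complex_of_real (exp (- (\<sigma> * s)\<^sup>2 / 2)))
      \<le> (expectation (\<lambda>x. \<bar>x\<bar> ^ 3) + \<sigma> ^ 3 * (LINT x|std_normal_distribution. \<bar>x\<bar> ^ 3)) * \<bar>s\<bar> ^ 3"
proof -
  have gen: "norm (char K s - (1 - s\<^sup>2 * v / 2)) \<le> (LINT x|K. \<bar>x\<bar> ^ 3) * \<bar>s\<bar> ^ 3"
    if K: "real_distribution K" and int: "integrable K (\<lambda>x. x)" "integrable K (\<lambda>x. x\<^sup>2)"
      "integrable K (\<lambda>x. \<bar>x\<bar> ^ 3)" and mean: "(LINT x|K. x) = 0" and var: "(LINT x|K. x\<^sup>2) = v" for K s v
  proof -
    interpret K: real_distribution K by fact
    have "norm (char K s - (1 - s\<^sup>2 * v / 2)) \<le> s\<^sup>2 / 6 * (LINT x|K. min (6 * x\<^sup>2) (\<bar>s\<bar> * \<bar>x\<bar> ^ 3))"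
      using int mean var by (intro K.char_approx3) auto
    also have "\<dots> \<le> s\<^sup>2 / 6 * (LINT x|K. \<bar>s\<bar> * \<bar>x\<bar> ^ 3)"
    proof (intro mult_left_mono integral_mono)
      show "integrable K (\<lambda>x. min (6 * x\<^sup>2) (\<bar>s\<bar> * \<bar>x\<bar> ^ 3))"
        using int by (intro integrable_min) auto
    qed (use int in auto)
    also have "\<dots> = (LINT x|K. \<bar>x\<bar> ^ 3) * \<bar>s\<bar> ^ 3 / 6"
      by (simp add: power3_eq_cube power2_eq_square)
    also have "\<dots> \<le> (LINT x|K. \<bar>x\<bar> ^ 3) * \<bar>s\<bar> ^ 3"
    proof -
      have "(LINT x|K. \<bar>x\<bar> ^ 3) * \<bar>s\<bar> ^ 3 \<ge> 0"
        by (intro mult_nonneg_nonneg Bochner_Integration.integral_nonneg) auto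
      then show ?thesis by simp
    qed
    finally show ?thesis .
  qed
  have M: "norm (char M s - (1 - s\<^sup>2 * \<sigma>\<^sup>2 / 2)) \<le> expectation (\<lambda>x. \<bar>x\<bar> ^ 3) * \<bar>s\<bar> ^ 3"
    using gen[OF real_distribution_axioms int mean var] by simp
  \<comment> \<open>Evaluating at \<open>\<sigma> * s\<close> gives the Gaussian variance
    \<open>\<sigma>\<^sup>2\<close>, so its quadratic polynomial is the one found for
    \<open>M\<close>.\<close>
  have "norm (char std_normal_distribution (\<sigma> * s) - (1 - (\<sigma> * s)\<^sup>2 * 1 / 2))
      \<le> (LINT x|std_normal_distribution. \<bar>x\<bar> ^ 3) * \<bar>\<sigma> * s\<bar> ^ 3"
    using gen[OF real_dist_normal_dist, of 1 "\<sigma> * s"] integrable_std_normal_distribution_moment[of 1]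
      integrable_std_normal_distribution_moment[of 2] integral_std_normal_distribution_moment_odd[of 1]
      std_normal_distribution_even_moments[of 1]
      integrable_abs[OF integrable_std_normal_distribution_moment[of 3]]
    by (simp add: power_abs)
  then have "norm (complex_of_real (exp (- (\<sigma> * s)\<^sup>2 / 2)) - (1 - s\<^sup>2 * \<sigma>\<^sup>2 / 2))
      \<le> \<sigma> ^ 3 * (LINT x|std_normal_distribution. \<bar>x\<bar> ^ 3) * \<bar>s\<bar> ^ 3"
    using \<open>\<sigma> \<ge> 0\<close>
    by (simp add: char_std_normal_distribution power_mult_distrib abs_mult mult_ac)
  with M show ?thesis
    using norm_triangle_ineq4[of "char M s - (1 - s\<^sup>2 * \<sigma>\<^sup>2 / 2)"
        "complex_of_real (exp (- (\<sigma> * s)\<^sup>2 / 2)) - (1 - s\<^sup>2 * \<sigma>\<^sup>2 / 2)"]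
    by (simp add: algebra_simps)
qed

text \<open>Leading term \<open>- u ^ 3 / 6\<close> of \<open>sin u - u\<close> at
  \<open>u = c / sqrt n\<close>. The proof splits on the sign of \<open>c\<close> to make the
  asymptotic expansion determinate.\<close>

lemma sin_cubic_limit:
  "(\<lambda>n. real n * sqrt (real n) * (sin (c / sqrt (real n)) - c / sqrt (real n))) \<longlonglongrightarrow> - (c ^ 3) / 6"
proof -
  consider "c = 0" | "c > 0" | "c < 0" by linarith
  then show ?thesis
  proof cases
    case 2
    then show ?thesis by (real_asymp simp: power3_eq_cube)
  next
    case 3
    then show ?thesis by (real_asymp simp: power3_eq_cube)
  qed simp
qed

section \<open>Third-order asymptotics of the characteristic functions of normalized sums\<close>

context real_distribution
begin

context
  fixes \<sigma> :: real
  assumes int: "integrable M (\<lambda>x. x)" "integrable M (\<lambda>x. x\<^sup>2)" "integrable M (\<lambda>x. \<bar>x\<bar> ^ 3)"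
    and mean: "expectation (\<lambda>x. x) = 0"
    and var: "expectation (\<lambda>x. x\<^sup>2) = \<sigma>\<^sup>2" and \<sigma>: "\<sigma> > 0"
begin

text \<open>Since the mean is zero, \<open>s * x\<close> may be subtracted from
  \<open>sin (s * x)\<close> under the expectation. The scaled difference converges pointwise by
  \<open>sin_cubic_limit\<close>, and the finite third absolute moment allows the limit under the
  integral.\<close>

lemma Im_char_limit:
  "(\<lambda>n. real n * sqrt (real n) * Im (char M (t / (sqrt (real n) * \<sigma>))))
     \<longlonglongrightarrow> - (expectation (\<lambda>x. x ^ 3) * t ^ 3 / (6 * \<sigma> ^ 3))"
proof -
  let ?f = "\<lambda>n x. real n * sqrt (real n) * (sin (t * x / \<sigma> / sqrt (real n)) - t * x / \<sigma> / sqrt (real n))"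
  have Im: "Im (char M s) = (LINT x|M. sin (s * x))" for s
    unfolding char_def by (subst integral_Im[symmetric]) (auto intro!: integrable_iexp simp: Im_exp)
  have isin: "integrable M (\<lambda>x. sin (s * x))" for s
    by (rule integrable_const_bound[where B = 1]) auto
  have eq: "real n * sqrt (real n) * Im (char M (t / (sqrt (real n) * \<sigma>))) = (LINT x|M. ?f n x)" for n
  proof -
    have "(LINT x|M. ?f n x) = (LINT x|M. real n * sqrt (real n) * (sin (t / (sqrt (real n) * \<sigma>) * x) - t / (sqrt (real n) * \<sigma>) * x))"
      by (intro Bochner_Integration.integral_cong) (auto simp: divide_simps mult_ac)
    also have "\<dots> = real n * sqrt (real n) * (LINT x|M. sin (t / (sqrt (real n) * \<sigma>) * x) - t / (sqrt (real n) * \<sigma>) * x)"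
      by simp
    also have "(LINT x|M. sin (t / (sqrt (real n) * \<sigma>) * x) - t / (sqrt (real n) * \<sigma>) * x) = (LINT x|M. sin (t / (sqrt (real n) * \<sigma>) * x))"
      using isin[of "t / (sqrt (real n) * \<sigma>)"] int(1) mean
      by (subst Bochner_Integration.integral_diff) (auto simp del: times_divide_eq_left)
    finally show ?thesis by (simp only: Im)
  qed
  have "(\<lambda>n. LINT x|M. ?f n x) \<longlonglongrightarrow> (LINT x|M. - ((t * x / \<sigma>) ^ 3) / 6)"
  proof (rule integral_dominated_convergence[where w = "\<lambda>x. (\<bar>t\<bar> / \<sigma>) ^ 3 / 6 * \<bar>x\<bar> ^ 3"])
    show "AE x in M. (\<lambda>n. ?f n x) \<longlonglongrightarrow> - ((t * x / \<sigma>) ^ 3) / 6"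
      using sin_cubic_limit by (intro AE_I2) blast
    show "AE x in M. norm (?f n x) \<le> (\<bar>t\<bar> / \<sigma>) ^ 3 / 6 * \<bar>x\<bar> ^ 3" for n
    proof (cases "n = 0")
      case False
      have "norm (?f n x) \<le> (\<bar>t\<bar> / \<sigma>) ^ 3 / 6 * \<bar>x\<bar> ^ 3" for x
      proof -
        have "norm (?f n x) \<le> real n * sqrt (real n) * (\<bar>t * x / \<sigma> / sqrt (real n)\<bar> ^ 3 / 6)"
          using abs_sin_diff_le[of "t * x / \<sigma> / sqrt (real n)"]
          unfolding real_norm_def abs_mult[of "real n * sqrt (real n)"] by (intro mult_mono) auto
        also have "\<dots> = (\<bar>t\<bar> / \<sigma>) ^ 3 / 6 * \<bar>x\<bar> ^ 3"
          using \<sigma> False by (simp add: abs_mult field_simps power3_eq_cube)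
        finally show ?thesis .
      qed
      then show ?thesis by simp
    qed (use \<sigma> in auto)
  qed (use int(3) in auto)
  also have "(LINT x|M. - ((t * x / \<sigma>) ^ 3) / 6) = (LINT x|M. - (t ^ 3 / (6 * \<sigma> ^ 3)) * x ^ 3)"
    by (intro Bochner_Integration.integral_cong) (auto simp: field_simps power_mult_distrib power_divide)
  finally show ?thesis
    unfolding eq by (simp add: mult_ac)
qed

text \<open>This is \<open>char_diff_normal_le\<close> at
  \<open>s = t / (sqrt n * \<sigma>)\<close>, with one \<open>K\<close> for all \<open>n\<close> and
  \<open>t\<close>. A single factor is within order \<open>n powr (-3/2)\<close> of its Gaussian
  counterpart, so the \<open>n\<close>-th powers are within order \<open>1 / sqrt n\<close>.\<close>

lemma char_normalized_bound:
  obtains K where "K \<ge> 0"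
    "\<And>n t. n > 0 \<Longrightarrow> norm (char M (t / (sqrt (real n) * \<sigma>)) - complex_of_real (exp (- t\<^sup>2 / (2 * real n))))
       \<le> K * \<bar>t\<bar> ^ 3 / (real n * sqrt (real n))"
proof -
  define K0 where "K0 = expectation (\<lambda>x. \<bar>x\<bar> ^ 3) + \<sigma> ^ 3 * (LINT x|std_normal_distribution. \<bar>x\<bar> ^ 3)"
  have "K0 \<ge> 0"
    unfolding K0_def using \<sigma>
    by (intro add_nonneg_nonneg mult_nonneg_nonneg Bochner_Integration.integral_nonneg) auto
  show ?thesis
  proof (rule that[of "K0 / \<sigma> ^ 3"])
    fix n :: nat and t :: real assume n: "n > 0"
    have "norm (char M (t / (sqrt (real n) * \<sigma>)) - complex_of_real (exp (- (\<sigma> * (t / (sqrt (real n) * \<sigma>)))\<^sup>2 / 2)))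
       \<le> K0 * \<bar>t / (sqrt (real n) * \<sigma>)\<bar> ^ 3"
      unfolding K0_def using \<sigma> by (intro char_diff_normal_le int mean var) auto
    also have "K0 * \<bar>t / (sqrt (real n) * \<sigma>)\<bar> ^ 3 = K0 / \<sigma> ^ 3 * \<bar>t\<bar> ^ 3 / (real n * sqrt (real n))"
      using \<sigma> n by (simp add: field_simps power3_eq_cube abs_mult)
    also have "- (\<sigma> * (t / (sqrt (real n) * \<sigma>)))\<^sup>2 / 2 = - t\<^sup>2 / (2 * real n)"
      using \<sigma> n by (simp add: field_simps power_mult_distrib)
    finally show "norm (char M (t / (sqrt (real n) * \<sigma>)) - complex_of_real (exp (- t\<^sup>2 / (2 * real n))))
       \<le> K0 / \<sigma> ^ 3 * \<bar>t\<bar> ^ 3 / (real n * sqrt (real n))" .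
  qed (use \<open>K0 \<ge> 0\<close> \<sigma> in auto)
qed

text \<open>Let \<open>a\<close> be the single factor and \<open>b\<close> its Gaussian counterpart.
  In \<open>a ^ n = b ^ n + n * b ^ (n - 1) * (a - b) + R\<close> the number \<open>b\<close> is
  real, so the imaginary part consists of \<open>n * b ^ (n - 1) * Im a\<close> and
  \<open>Im R\<close>. By \<open>norm_power_second_order_le\<close>, \<open>R\<close> has order
  \<open>1 / n\<close>, negligible after scaling by \<open>sqrt n\<close>;
  \<open>Im_char_limit\<close> gives the linear term.\<close>

lemma Im_char_power_limit:
  "(\<lambda>n. sqrt (real n) * Im (char M (t / (sqrt (real n) * \<sigma>)) ^ n))
     \<longlonglongrightarrow> - (expectation (\<lambda>x. x ^ 3) / (6 * \<sigma> ^ 3)) * (t ^ 3 * exp (- t\<^sup>2 / 2))"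
proof -
  obtain K where K: "K \<ge> 0"
    "\<And>n t. n > 0 \<Longrightarrow> norm (char M (t / (sqrt (real n) * \<sigma>)) - complex_of_real (exp (- t\<^sup>2 / (2 * real n))))
       \<le> K * \<bar>t\<bar> ^ 3 / (real n * sqrt (real n))"
    by (rule char_normalized_bound) blast
  define a where "a n = char M (t / (sqrt (real n) * \<sigma>))" for n
  define b where "b n = exp (- t\<^sup>2 / (2 * real n))" for n
  define c where "c = K * \<bar>t\<bar> ^ 3"
  define R where "R n = a n ^ n - complex_of_real (b n) ^ n
    - of_nat n * complex_of_real (b n) ^ (n - 1) * (a n - complex_of_real (b n))" for n
  have R: "norm (R n) \<le> c\<^sup>2 / real n" if n: "n > 0" for n
  proof -
    obtain m where m: "n = Suc m" using n by (cases n) auto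
    have "norm (R n) \<le> (real n)\<^sup>2 * (norm (a n - b n))\<^sup>2"
      unfolding R_def m diff_Suc_1
      by (rule norm_power_second_order_le) (auto simp: a_def b_def cmod_char_le_1)
    also have "\<dots> \<le> (real n)\<^sup>2 * (c / (real n * sqrt (real n)))\<^sup>2"
      using K(2)[OF n, of t] by (intro mult_left_mono power_mono) (auto simp: a_def b_def c_def)
    also have "\<dots> = c\<^sup>2 / real n"
      using n by (simp add: field_simps power_mult_distrib power2_eq_square)
    finally show ?thesis .
  qed
  have "(\<lambda>n. sqrt (real n) * Im (R n)) \<longlonglongrightarrow> 0"
  proof (rule Lim_null_comparison)
    show "\<forall>\<^sub>F n in sequentially. norm (sqrt (real n) * Im (R n)) \<le> sqrt (real n) * (c\<^sup>2 / real n)"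
      using eventually_gt_at_top[of 0]
    proof eventually_elim
      case (elim n)
      then show ?case
        using R[of n] abs_Im_le_cmod[of "R n"] unfolding real_norm_def abs_mult by (intro mult_mono) auto
    qed
    show "(\<lambda>n. sqrt (real n) * (c\<^sup>2 / real n)) \<longlonglongrightarrow> 0"
      by real_asymp
  qed
  moreover have "(\<lambda>n. (real n * sqrt (real n) * Im (a n)) * b n ^ (n - 1))
      \<longlonglongrightarrow> - (expectation (\<lambda>x. x ^ 3) * t ^ 3 / (6 * \<sigma> ^ 3)) * exp (- t\<^sup>2 / 2)"
  proof (rule tendsto_mult)
    show "(\<lambda>n. real n * sqrt (real n) * Im (a n)) \<longlonglongrightarrow> - (expectation (\<lambda>x. x ^ 3) * t ^ 3 / (6 * \<sigma> ^ 3))"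
      unfolding a_def by (rule Im_char_limit)
    \<comment> \<open>The exponent is \<open>(n - 1) / n\<close> times
      \<open>- t\<^sup>2 / 2\<close>. Identifying it with \<open>b n ^ (n - 1)\<close> takes
      \<open>n > 0\<close>, since subtraction on naturals truncates and division by zero gives
      zero.\<close>
    have "(\<lambda>n. exp (- t\<^sup>2 / 2 + t\<^sup>2 / 2 * (1 / real n))) \<longlonglongrightarrow> exp (- t\<^sup>2 / 2 + t\<^sup>2 / 2 * 0)"
      by (intro tendsto_intros lim_1_over_n)
    moreover have "\<forall>\<^sub>F n in sequentially. exp (- t\<^sup>2 / 2 + t\<^sup>2 / 2 * (1 / real n)) = b n ^ (n - 1)"
      using eventually_gt_at_top[of 0]
    proof eventually_elim
      case (elim n)
      then show ?case
        unfolding b_def exp_of_nat_mult[symmetric] by (simp add: field_simps of_nat_diff)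
    qed
    ultimately show "(\<lambda>n. b n ^ (n - 1)) \<longlonglongrightarrow> exp (- t\<^sup>2 / 2)"
      by (simp add: tendsto_cong)
  qed
  ultimately have "(\<lambda>n. sqrt (real n) * Im (R n) + (real n * sqrt (real n) * Im (a n)) * b n ^ (n - 1))
      \<longlonglongrightarrow> 0 + - (expectation (\<lambda>x. x ^ 3) * t ^ 3 / (6 * \<sigma> ^ 3)) * exp (- t\<^sup>2 / 2)"
    by (rule tendsto_add)
  moreover have "sqrt (real n) * Im (R n) + (real n * sqrt (real n) * Im (a n)) * b n ^ (n - 1)
      = sqrt (real n) * Im (a n ^ n)" for n
  proof -
    have ImR: "Im (R n) = Im (a n ^ n) - real n * b n ^ (n - 1) * Im (a n)"
    proof -
      have "R n = a n ^ n - complex_of_real (b n ^ n)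
          - complex_of_real (real n * b n ^ (n - 1)) * (a n - complex_of_real (b n))"
        by (simp add: R_def)
      then show ?thesis
        by (simp del: of_real_power of_real_mult)
    qed
    show ?thesis
      unfolding ImR by (simp add: algebra_simps)
  qed
  ultimately show ?thesis
    by (simp add: a_def mult_ac)
qed

text \<open>The Gaussian characteristic function is real, hence may be subtracted from the power for free;
  then \<open>\<bar>a\<^sup>n - b\<^sup>n\<bar> \<le> n \<bar>a - b\<bar>\<close> suffices.\<close>

lemma Im_char_power_bound:
  obtains K where "K \<ge> 0"
    "\<And>n t. \<bar>sqrt (real n) * Im (char M (t / (sqrt (real n) * \<sigma>)) ^ n)\<bar> \<le> K * \<bar>t\<bar> ^ 3"
proof -
  obtain K where K: "K \<ge> 0"
    "\<And>n t. n > 0 \<Longrightarrow> norm (char M (t / (sqrt (real n) * \<sigma>)) - complex_of_real (exp (- t\<^sup>2 / (2 * real n))))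
       \<le> K * \<bar>t\<bar> ^ 3 / (real n * sqrt (real n))"
    by (rule char_normalized_bound) blast
  show ?thesis
  proof (rule that[OF K(1)])
    fix n :: nat and t :: real
    show "\<bar>sqrt (real n) * Im (char M (t / (sqrt (real n) * \<sigma>)) ^ n)\<bar> \<le> K * \<bar>t\<bar> ^ 3"
    proof (cases "n = 0")
      case False
      define a where "a = char M (t / (sqrt (real n) * \<sigma>))"
      define b where "b = complex_of_real (exp (- t\<^sup>2 / (2 * real n)))"
      have "Im (a ^ n) = Im (a ^ n - b ^ n)"
        unfolding b_def by (simp flip: of_real_power)
      also have "\<bar>\<dots>\<bar> \<le> norm (a ^ n - b ^ n)"
        by (rule abs_Im_le_cmod)
      also have "\<dots> \<le> real n * norm (a - b)"
        by (rule norm_power_diff) (auto simp: a_def b_def cmod_char_le_1)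
      also have "\<dots> \<le> real n * (K * \<bar>t\<bar> ^ 3 / (real n * sqrt (real n)))"
        using K(2)[of n t] False by (intro mult_left_mono) (auto simp: a_def b_def)
      also have "\<dots> = K * \<bar>t\<bar> ^ 3 / sqrt (real n)"
        using False by simp
      finally show ?thesis
        using False by (simp add: abs_mult a_def field_simps)
    qed (use K in auto)
  qed
qed

text \<open>Dominated convergence: \<open>Im_char_power_limit\<close> gives the pointwise limit and
  \<open>Im_char_power_bound\<close> the majorant \<open>K * t ^ 4\<close>, which has finite
  Gaussian integral. The extra factor \<open>t\<close> makes the power even, so the limiting
  integral does not cancel.\<close>

lemma integral_Im_char_power_limit:
  "(\<lambda>n. sqrt (real n) * (LINT t|std_normal_distribution. t * Im (char M (t / (sqrt (real n) * \<sigma>)) ^ n)))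
     \<longlonglongrightarrow> - (expectation (\<lambda>x. x ^ 3) / (6 * \<sigma> ^ 3))
           * (LINT t|std_normal_distribution. t ^ 4 * exp (- t\<^sup>2 / 2))"
proof -
  obtain K where K: "K \<ge> 0"
    "\<And>n t. \<bar>sqrt (real n) * Im (char M (t / (sqrt (real n) * \<sigma>)) ^ n)\<bar> \<le> K * \<bar>t\<bar> ^ 3"
    by (rule Im_char_power_bound) blast
  let ?m = "- (expectation (\<lambda>x. x ^ 3) / (6 * \<sigma> ^ 3))"
  have "(\<lambda>n. LINT t|std_normal_distribution. t * (sqrt (real n) * Im (char M (t / (sqrt (real n) * \<sigma>)) ^ n)))
     \<longlonglongrightarrow> (LINT t|std_normal_distribution. t * (?m * (t ^ 3 * exp (- t\<^sup>2 / 2))))"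
  proof (rule integral_dominated_convergence[where w = "\<lambda>t. K * t ^ 4"])
    show "AE t in std_normal_distribution.
        (\<lambda>n. t * (sqrt (real n) * Im (char M (t / (sqrt (real n) * \<sigma>)) ^ n)))
          \<longlonglongrightarrow> t * (?m * (t ^ 3 * exp (- t\<^sup>2 / 2)))"
      by (intro AE_I2 tendsto_mult_left Im_char_power_limit)
    show "AE t in std_normal_distribution.
        norm (t * (sqrt (real n) * Im (char M (t / (sqrt (real n) * \<sigma>)) ^ n))) \<le> K * t ^ 4" for n
    proof (intro AE_I2)
      fix t :: real
      have "norm (t * (sqrt (real n) * Im (char M (t / (sqrt (real n) * \<sigma>)) ^ n))) \<le> \<bar>t\<bar> * (K * \<bar>t\<bar> ^ 3)"
        unfolding real_norm_def abs_mult[of t] by (intro mult_left_mono K(2)) auto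
      also have "\<dots> = K * \<bar>t\<bar> ^ 4"
        by (simp add: eval_nat_numeral)
      finally show "norm (t * (sqrt (real n) * Im (char M (t / (sqrt (real n) * \<sigma>)) ^ n))) \<le> K * t ^ 4"
        by simp
    qed
    show "integrable std_normal_distribution (\<lambda>t. K * t ^ 4)"
      by (intro integrable_mult_right integrable_std_normal_distribution_moment)
  qed auto
  moreover have "(LINT t|std_normal_distribution. t * (?m * (t ^ 3 * exp (- t\<^sup>2 / 2))))
      = (LINT t|std_normal_distribution. ?m * (t ^ 4 * exp (- t\<^sup>2 / 2)))"
    by (intro Bochner_Integration.integral_cong) (auto simp: eval_nat_numeral)
  moreover have "(LINT t|std_normal_distribution. t * (sqrt (real n) * Im (char M (t / (sqrt (real n) * \<sigma>)) ^ n)))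
      = (LINT t|std_normal_distribution. sqrt (real n) * (t * Im (char M (t / (sqrt (real n) * \<sigma>)) ^ n)))" for n
    by (intro Bochner_Integration.integral_cong) auto
  ultimately show ?thesis
    by (simp only: integral_mult_right_zero)
qed

end

end

text \<open>Only the sign matters for the final constant. If this integral of a nonnegative function
  vanished, \<open>t\<close> would be zero almost everywhere, contradicting unit variance.\<close>

lemma std_normal_weighted_fourth_moment_pos: "(LINT t|std_normal_distribution. t ^ 4 * exp (- t\<^sup>2 / 2)) > 0"
proof -
  interpret N: real_distribution std_normal_distribution
    by (rule real_dist_normal_dist)
  have int: "integrable std_normal_distribution (\<lambda>t. t ^ 4 * exp (- t\<^sup>2 / 2))"
    using integrable_std_normal_distribution_moment[of 4]
    by (rule Bochner_Integration.integrable_bound) (auto simp: abs_mult intro!: mult_left_le)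
  have 1: "(LINT t|std_normal_distribution. t ^ 4 * exp (- t\<^sup>2 / 2)) \<noteq> 0"
  proof
    assume "(LINT t|std_normal_distribution. t ^ 4 * exp (- t\<^sup>2 / 2)) = 0"
    then have "AE t in std_normal_distribution. t ^ 4 * exp (- t\<^sup>2 / 2) = 0"
      using integral_nonneg_eq_0_iff_AE[OF int] by simp
    then have "AE t in std_normal_distribution. t\<^sup>2 = 0"
      by eventually_elim simp
    then have "(LINT t|std_normal_distribution. t\<^sup>2) = 0"
      by (simp add: integral_eq_zero_AE)
    then show False
      using std_normal_distribution_even_moments[of 1] by simp
  qed
  have "(LINT t|std_normal_distribution. t ^ 4 * exp (- t\<^sup>2 / 2)) \<ge> 0"
    by (intro Bochner_Integration.integral_nonneg) auto
  with 1 show ?thesis by linarith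
qed

section \<open>Normalized sums and the lower bound for the ratio of \<open>Delta\<close> to the
  weighted Lindeberg fraction\<close>

lemma admissible_real_distribution:
  assumes "admissible_dist M"
  shows "real_distribution M"
proof -
  have "space M = UNIV"
    using assms sets_eq_imp_space_eq[of M borel] by (simp add: admissible_dist_def)
  then show ?thesis
    using assms by (simp add: admissible_dist_def real_distribution_def real_distribution_axioms_def)
qed

lemma char_distr_PiM_sum:
  fixes c :: real
  assumes "real_distribution M" "finite I"
  shows "char (distr (PiM I (\<lambda>_. M)) borel (\<lambda>\<omega>. (\<Sum>i\<in>I. \<omega> i) / c)) t = char M (t / c) ^ card I"
proof -
  interpret M: real_distribution M by fact
  interpret P: product_sigma_finite "\<lambda>_. M" ..
  have meas [measurable]: "(\<lambda>\<omega>. (\<Sum>i\<in>I. \<omega> i) / c) \<in> borel_measurable (PiM I (\<lambda>_. M))"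
    by measurable
  have "char (distr (PiM I (\<lambda>_. M)) borel (\<lambda>\<omega>. (\<Sum>i\<in>I. \<omega> i) / c)) t
      = (CLINT \<omega>|PiM I (\<lambda>_. M). iexp (t * ((\<Sum>i\<in>I. \<omega> i) / c)))"
    unfolding char_def by (subst integral_distr) auto
  also have "\<dots> = (CLINT \<omega>|PiM I (\<lambda>_. M). (\<Prod>i\<in>I. iexp (t / c * \<omega> i)))"
    using assms(2) by (simp flip: exp_sum add: sum_divide_distrib sum_distrib_left)
  also have "\<dots> = (\<Prod>i\<in>I. CLINT x|M. iexp (t / c * x))"
    using assms(2) by (intro P.product_integral_prod M.integrable_iexp) auto
  finally show ?thesis
    by (simp add: char_def)
qed

text \<open>Positivity of \<open>Bn n M\<close> turns the event in \<open>Delta\<close> into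
  \<open>{..<x}\<close> under the normalized law, and the bound 1 on all deviations makes the real
  supremum a genuine upper bound.\<close>

lemma normalized_sum_le_Delta:
  assumes "admissible_dist M" "n > 0"
  defines "\<mu> \<equiv> distr (PiM {..<n} (\<lambda>_. M)) borel (\<lambda>\<omega>. (\<Sum>i<n. \<omega> i) / Bn n M)"
  shows "\<bar>measure \<mu> {..<x} - Phi x\<bar> \<le> Delta n M" "real_distribution \<mu>"
proof -
  interpret M: real_distribution M
    using assms(1) by (rule admissible_real_distribution)
  interpret P: product_prob_space "\<lambda>_. M" "{..<n}" ..
  interpret N: real_distribution std_normal_distribution
    by (rule real_dist_normal_dist)
  let ?P = "PiM {..<n} (\<lambda>_. M)"
  have meas [measurable]: "(\<lambda>\<omega>. (\<Sum>i<n. \<omega> i) / Bn n M) \<in> borel_measurable ?P"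
    by measurable
  show \<mu>: "real_distribution \<mu>"
    unfolding \<mu>_def using P.prob_space_axioms
    by (auto simp: real_distribution_def real_distribution_axioms_def intro!: prob_space.prob_space_distr)
  interpret \<mu>: real_distribution \<mu> by fact
  have "Bn n M > 0"
    using assms(1,2) by (simp add: Bn_def sigma2_def admissible_dist_def)
  then have eq: "measure ?P {\<omega> \<in> space ?P. (\<Sum>i<n. \<omega> i) < y * Bn n M} = measure \<mu> {..<y}" for y
    unfolding \<mu>_def by (subst measure_distr) (auto intro!: arg_cong[where f = "measure ?P"] simp: field_simps)
  have "\<bar>measure \<mu> {..<y} - Phi y\<bar> \<le> 1" for y
    using \<mu>.prob_le_1[of "{..<y}"] N.prob_le_1[of "{..<y}"] measure_nonneg[of \<mu> "{..<y}"]
      measure_nonneg[of std_normal_distribution "{..<y}"]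
    unfolding Phi_def by linarith
  then have "bdd_above (range (\<lambda>y. \<bar>measure \<mu> {..<y} - Phi y\<bar>))"
    by (intro bdd_aboveI2)
  then show "\<bar>measure \<mu> {..<x} - Phi x\<bar> \<le> Delta n M"
    unfolding Delta_def eq by (intro cSUP_upper) auto
qed

text \<open>The assumption \<open>1 \<le> \<bar>x\<bar>\<close> keeps the denominator away from the junk value \<open>x / 0 = 0\<close>.\<close>

lemma limsup_ratio_ge:
  "\<exists>c>0. \<forall>\<epsilon> M A. \<epsilon> > 0 \<longrightarrow> admissible_dist M \<longrightarrow> integrable M (\<lambda>x. \<bar>x\<bar> ^ 3) \<longrightarrow>
     (AE x in M. 1 \<le> \<bar>x\<bar>) \<longrightarrow> A > 0 \<longrightarrow>
     (\<forall>t>0. t * (LINT x|M. x\<^sup>2 * indicator {x. \<bar>x\<bar> \<ge> t} x) \<le> A) \<longrightarrow>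
     ereal (c * (LINT x|M. x ^ 3) / A)
       \<le> limsup (\<lambda>n. ereal (Delta n M / (SUP z\<in>{0<..\<epsilon>}. z * Lind n M z)))"
proof -
  obtain C where C: "C > 0" "\<And>M D. real_distribution M \<Longrightarrow> (\<And>x. \<bar>measure M {..<x} - Phi x\<bar> \<le> D) \<Longrightarrow>
     \<bar>LINT t|std_normal_distribution. t * Im (char M t)\<bar> \<le> C * D"
    using integral_Im_char_le_Kolmogorov_distance by blast
  define \<kappa> where "\<kappa> = (LINT t|std_normal_distribution. t ^ 4 * exp (- t\<^sup>2 / 2))"
  have "\<kappa> > 0"
    unfolding \<kappa>_def by (rule std_normal_weighted_fourth_moment_pos)
  \<comment> \<open>The 6 is the factor in \<open>integral_Im_char_power_limit\<close>, and
    \<open>C\<close> is the loss in passing from \<open>\<bar>I n\<bar>\<close> to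
    \<open>Delta n M\<close>; the powers of \<open>\<sigma>\<close> cancel at the end.\<close>
  define c where "c = \<kappa> / (6 * C)"
  have "c > 0"
    using \<open>\<kappa> > 0\<close> C(1) by (simp add: c_def)
  moreover have "ereal (c * (LINT x|M. x ^ 3) / A)
       \<le> limsup (\<lambda>n. ereal (Delta n M / (SUP z\<in>{0<..\<epsilon>}. z * Lind n M z)))"
    if \<epsilon>: "\<epsilon> > 0" and M: "admissible_dist M" and int3: "integrable M (\<lambda>x. \<bar>x\<bar> ^ 3)"
      and ge1: "AE x in M. 1 \<le> \<bar>x\<bar>" and A: "A > 0"
      and tail: "\<And>t. t > 0 \<Longrightarrow> t * (LINT x|M. x\<^sup>2 * indicator {x. \<bar>x\<bar> \<ge> t} x) \<le> A" for \<epsilon> M A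
  proof -
    interpret real_distribution M
      using M by (rule admissible_real_distribution)
    define \<sigma> where "\<sigma> = sqrt (sigma2 M)"
    have \<sigma>: "\<sigma> > 0" "sigma2 M = \<sigma>\<^sup>2"
      using M by (auto simp: \<sigma>_def admissible_dist_def sigma2_def)
    have B: "Bn n M = sqrt (real n) * \<sigma>" for n
      by (simp add: Bn_def \<sigma>_def real_sqrt_mult)
    define I where "I n = (LINT t|std_normal_distribution. t * Im (char M (t / (sqrt (real n) * \<sigma>)) ^ n))" for n
    define T where "T t = (LINT x|M. x\<^sup>2 * indicator {x. \<bar>x\<bar> \<ge> t} x)" for t :: real
    have L: "z * Lind n M z = z * T (z * Bn n M) / \<sigma>\<^sup>2" if "n > 0" for z n
      using that \<sigma> by (simp add: Lind_def T_def[symmetric] B power_mult_distrib)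
    \<comment> \<open>The bound \<open>A\<close> on the weak third moment is used at
      \<open>t = z * Bn n M\<close>; dividing by \<open>Bn n M\<close> and by the variance gives a
      bound uniform in \<open>z\<close>.\<close>
    have L_le: "z * Lind n M z \<le> A / (\<sigma> ^ 3 * sqrt (real n))" if "n > 0" "z > 0" for z n
    proof -
      have "(z * Bn n M) * T (z * Bn n M) \<le> A"
        unfolding T_def using that \<sigma> by (intro tail) (auto simp: B)
      then have "z * T (z * Bn n M) \<le> A / Bn n M"
        using that \<sigma> by (simp add: B field_simps)
      then have "z * T (z * Bn n M) / \<sigma>\<^sup>2 \<le> A / Bn n M / \<sigma>\<^sup>2"
        by (intro divide_right_mono) auto
      also have "\<dots> = A / (\<sigma> ^ 3 * sqrt (real n))"
        by (simp add: B power2_eq_square power3_eq_cube mult_ac)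
      finally show ?thesis
        using L[OF that(1)] by simp
    qed
    \<comment> \<open>The sign is flipped because \<open>sqrt n * I n\<close> tends to a negative
      multiple of the third moment.\<close>
    have ratio: "sqrt (real n) * (- I n) * (\<sigma> ^ 3 / (C * A)) \<le> Delta n M / (SUP z\<in>{0<..\<epsilon>}. z * Lind n M z)"
      if n: "n > 0" for n
    proof -
      define D where "D = (SUP z\<in>{0<..\<epsilon>}. z * Lind n M z)"
      have D_le: "D \<le> A / (\<sigma> ^ 3 * sqrt (real n))"
        unfolding D_def using \<epsilon> n by (intro cSUP_least L_le) auto
      \<comment> \<open>This \<open>z\<close> puts the truncation level \<open>z * Bn n M\<close> at
        or below 1, so that almost surely nothing is cut off. There \<open>z * Lind n M z\<close>
        equals \<open>z\<close>, which makes the supremum strictly positive.\<close>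
      define z where "z = min \<epsilon> (1 / Bn n M)"
      have Bpos: "Bn n M > 0"
        using n \<sigma> by (simp add: B)
      have z: "z > 0" "z \<le> \<epsilon>" "z * Bn n M \<le> 1"
        using \<epsilon> Bpos by (auto simp: z_def min_def field_simps)
      have "T (z * Bn n M) = (LINT x|M. x\<^sup>2)"
        unfolding T_def
      proof (rule integral_cong_AE)
        show "AE x in M. x\<^sup>2 * indicator {x. z * Bn n M \<le> \<bar>x\<bar>} x = x\<^sup>2"
          using ge1 by eventually_elim (use z in \<open>auto simp: indicator_def\<close>)
      qed auto
      then have "z * Lind n M z > 0"
        unfolding L[OF n] using z \<sigma> M by (simp add: admissible_dist_def)
      also have "z * Lind n M z \<le> D"
        unfolding D_def using z L_le[OF n]
        by (intro cSUP_upper bdd_aboveI2[where M = "A / (\<sigma> ^ 3 * sqrt (real n))"]) auto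
      finally have "D > 0" .
      have "\<bar>I n\<bar> \<le> C * Delta n M"
      proof -
        have "\<bar>LINT t|std_normal_distribution. t * Im (char (distr (PiM {..<n} (\<lambda>_. M)) borel
            (\<lambda>\<omega>. (\<Sum>i<n. \<omega> i) / Bn n M)) t)\<bar> \<le> C * Delta n M"
          using normalized_sum_le_Delta[OF M n] by (intro C(2)) auto
        then show ?thesis
          by (simp add: char_distr_PiM_sum[OF real_distribution_axioms] I_def B)
      qed
      then have I: "\<bar>I n\<bar> / C \<le> Delta n M"
        using C(1) by (simp add: field_simps)
      have "sqrt (real n) * (- I n) * (\<sigma> ^ 3 / (C * A)) \<le> sqrt (real n) * \<bar>I n\<bar> * (\<sigma> ^ 3 / (C * A))"
        using \<sigma> C(1) A by (intro mult_right_mono mult_left_mono) auto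
      also have "\<dots> = (\<bar>I n\<bar> / C) / (A / (\<sigma> ^ 3 * sqrt (real n)))"
        by simp
      also have "\<dots> \<le> Delta n M / D"
        using I D_le \<open>D > 0\<close> C(1) by (intro frac_le) (auto intro: order_trans[OF _ I])
      finally show ?thesis
        unfolding D_def .
    qed
    have "(\<lambda>n. sqrt (real n) * I n) \<longlonglongrightarrow> - (expectation (\<lambda>x. x ^ 3) / (6 * \<sigma> ^ 3)) * \<kappa>"
      unfolding I_def \<kappa>_def using M int3 \<sigma>
      by (intro integral_Im_char_power_limit) (auto simp: admissible_dist_def sigma2_def)
    then have "(\<lambda>n. - (sqrt (real n) * I n) * (\<sigma> ^ 3 / (C * A)))
        \<longlonglongrightarrow> - (- (expectation (\<lambda>x. x ^ 3) / (6 * \<sigma> ^ 3)) * \<kappa>) * (\<sigma> ^ 3 / (C * A))"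
      by (intro tendsto_mult_right tendsto_minus)
    also have "- (- (expectation (\<lambda>x. x ^ 3) / (6 * \<sigma> ^ 3)) * \<kappa>) * (\<sigma> ^ 3 / (C * A))
        = c * expectation (\<lambda>x. x ^ 3) / A"
      using \<sigma> by (simp add: c_def mult_ac)
    finally have "ereal (c * expectation (\<lambda>x. x ^ 3) / A)
        = limsup (\<lambda>n. ereal (- (sqrt (real n) * I n) * (\<sigma> ^ 3 / (C * A))))"
      by (intro lim_imp_Limsup[symmetric]) auto
    also have "\<dots> \<le> limsup (\<lambda>n. ereal (Delta n M / (SUP z\<in>{0<..\<epsilon>}. z * Lind n M z)))"
    proof (rule Limsup_mono)
      show "\<forall>\<^sub>F n in sequentially. ereal (- (sqrt (real n) * I n) * (\<sigma> ^ 3 / (C * A)))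
          \<le> ereal (Delta n M / (SUP z\<in>{0<..\<epsilon>}. z * Lind n M z))"
        using eventually_gt_at_top[of 0] by eventually_elim (use ratio in simp)
    qed
    finally show ?thesis .
  qed
  ultimately show ?thesis by blast
qed

section \<open>The dyadic law with bounded weak third moment and large third moment\<close>

text \<open>The nonzero terms form a geometric series with ratio 1/2 whose first term is at most 1.
  Keeping the subtracted \<open>t / 2 ^ N\<close> in the bound is what lets the induction close; a
  bare 2 would not.\<close>

lemma sum_dyadic_tail_le:
  fixes t :: real
  assumes "t > 0"
  shows "(\<Sum>k=1..N. if t \<le> 2 ^ k then t / 2 ^ k else 0) \<le> (if t \<le> 2 ^ N then 2 - t / 2 ^ N else 0)"
proof (induction N)
  case (Suc N)
  let ?s = "\<Sum>k=1..N. if t \<le> 2 ^ k then t / 2 ^ k else 0"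
  have split: "(\<Sum>k=1..Suc N. if t \<le> 2 ^ k then t / 2 ^ k else 0)
      = ?s + (if t \<le> 2 ^ Suc N then t / 2 ^ Suc N else 0)"
    by simp
  consider "t \<le> 2 ^ N" | "2 ^ N < t" "t \<le> 2 ^ Suc N" | "2 ^ Suc N < t"
    by linarith
  then show ?case
  proof cases
    case 1
    then have "t \<le> 2 ^ Suc N"
      using assms by simp
    with 1 show ?thesis
      using Suc unfolding split by simp
  next
    case 2
    then have "?s \<le> 0" "t / 2 ^ Suc N \<le> 1"
      using Suc by auto
    moreover have "(if t \<le> 2 ^ Suc N then t / 2 ^ Suc N else 0) = t / 2 ^ Suc N"
      "(if t \<le> 2 ^ Suc N then 2 - t / 2 ^ Suc N else 0) = 2 - t / 2 ^ Suc N"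
      using 2 by simp_all
    ultimately show ?thesis
      unfolding split by linarith
  next
    case 3
    then have "\<not> t \<le> 2 ^ N"
      using assms by simp
    with 3 show ?thesis
      using Suc unfolding split by simp
  qed
qed auto

text \<open>A mixture over \<open>1 \<le> k \<le> N\<close>, with weights proportional to \<open>4\<^sup>-\<^sup>k\<close>, of the centred two-point laws
  on \<open>{2\<^sup>k, -1}\<close>: the third moment grows linearly in \<open>N\<close>, while the weak third moment stays bounded.\<close>

lemma dyadic_two_point_mixture:
  assumes "N \<ge> (1 :: nat)"
  obtains M :: "real measure" and c :: real where "prob_space M" "sets M = sets borel" "c > 0"
    "\<And>f :: real \<Rightarrow> real. f \<in> borel_measurable borel \<Longrightarrow> integrable M f"
    "\<And>f. f \<in> borel_measurable borel \<Longrightarrow>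
       (LINT x|M. f x) = (\<Sum>k=1..N. c / (4 ^ k * (2 ^ k + 1)) * (f (2 ^ k) + 2 ^ k * f (- 1)))"
    "AE x in M. 1 \<le> \<bar>x\<bar>"
proof -
  define S :: real where "S = (\<Sum>k=1..N. 1 / 4 ^ k)"
  have "S > 0"
    unfolding S_def using assms by (intro sum_pos) auto
  \<comment> \<open>Each pair \<open>{2 ^ k, -1}\<close> is to receive total mass
    \<open>c / 4 ^ k\<close>, so \<open>1 / S\<close> normalizes.\<close>
  define c where "c = 1 / S"
  have "c > 0"
    using \<open>S > 0\<close> by (simp add: c_def)
  \<comment> \<open>Within pair \<open>k\<close> the masses of \<open>2 ^ k\<close> and
    \<open>-1\<close> stand in proportion \<open>1 : 2 ^ k\<close>, which centres the pair. The
    weights live on labels \<open>(k, b)\<close> because all pairs share the atom \<open>-1\<close>;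
    taking the image under \<open>X\<close> merges these copies.\<close>
  define w where "w = (\<lambda>(k, b). if k \<in> {1..N} then c / (4 ^ k * (2 ^ k + 1)) * (if b then 1 else 2 ^ k) else 0 :: real)"
  define X where "X = (\<lambda>(k :: nat, b). if b then 2 ^ k else - 1 :: real)"
  let ?A = "{1..N} \<times> (UNIV :: bool set)"
  have w_nonneg: "w p \<ge> 0" for p
    using \<open>c > 0\<close> by (auto simp: w_def split: prod.splits)
  have sum_w: "(\<Sum>p\<in>?A. g (X p) * w p) = (\<Sum>k=1..N. c / (4 ^ k * (2 ^ k + 1)) * (g (2 ^ k) + 2 ^ k * g (- 1)))"
    for g :: "real \<Rightarrow> real"
  proof -
    have "(\<Sum>p\<in>?A. g (X p) * w p) = (\<Sum>k=1..N. \<Sum>b\<in>UNIV. g (X (k, b)) * w (k, b))"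
      by (simp add: sum.cartesian_product)
    also have "\<dots> = (\<Sum>k=1..N. c / (4 ^ k * (2 ^ k + 1)) * (g (2 ^ k) + 2 ^ k * g (- 1)))"
      by (intro sum.cong refl) (simp add: w_def X_def UNIV_bool distrib_left add_divide_distrib mult_ac)
    finally show ?thesis .
  qed
  have "(\<Sum>p\<in>?A. w p) = (\<Sum>k=1..N. c * (1 / 4 ^ k))"
  proof -
    have "c / (4 ^ k * (2 ^ k + 1)) * (1 + 2 ^ k * 1) = c * (1 / 4 ^ k)" for k :: nat
    proof -
      have "(2 ^ k + 1 :: real) \<noteq> 0"
        by (metis add_pos_pos less_irrefl zero_less_numeral zero_less_one zero_less_power)
      then show ?thesis by (simp add: divide_simps)
    qed
    then show ?thesis
      using sum_w[of "\<lambda>_. 1"] by (simp only: mult_1_left)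
  qed
  also have "\<dots> = 1"
    unfolding sum_distrib_left[symmetric] S_def[symmetric] c_def using \<open>S > 0\<close> by simp
  finally have total: "(\<Sum>p\<in>?A. w p) = 1" .
  have "(\<integral>\<^sup>+ p. ennreal (w p) \<partial>count_space UNIV) = (\<Sum>p\<in>?A. ennreal (w p))"
    by (rule nn_integral_count_space') (auto simp: w_def split: if_splits)
  also have "\<dots> = 1"
    using total by (simp add: sum_ennreal w_nonneg)
  finally have nn: "(\<integral>\<^sup>+ p. ennreal (w p) \<partial>count_space UNIV) = 1" .
  define p where "p = embed_pmf w"
  have pmf: "pmf p = w"
    unfolding p_def using w_nonneg nn by (intro ext pmf_embed_pmf) auto
  have set: "set_pmf p \<subseteq> ?A"
    unfolding set_pmf_eq pmf by (auto simp: w_def split: if_splits)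
  define M where "M = distr (measure_pmf p) borel X"
  show ?thesis
  proof (rule that[of M c])
    show "prob_space M"
      unfolding M_def by (rule measure_pmf.prob_space_distr) simp
    show "integrable M f" if [measurable]: "f \<in> borel_measurable borel" for f :: "real \<Rightarrow> real"
      unfolding M_def using finite_subset[OF set]
      by (subst integrable_distr_eq) (auto intro: integrable_measure_pmf_finite)
    show "(LINT x|M. f x) = (\<Sum>k=1..N. c / (4 ^ k * (2 ^ k + 1)) * (f (2 ^ k) + 2 ^ k * f (- 1)))"
      if [measurable]: "f \<in> borel_measurable borel" for f
    proof -
      have "(LINT x|M. f x) = (LINT q|measure_pmf p. f (X q))"
        unfolding M_def by (subst integral_distr) auto
      also have "\<dots> = (\<Sum>q\<in>?A. f (X q) * pmf p q)"
        using set by (intro integral_measure_pmf_real) auto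
      finally show ?thesis
        by (simp only: pmf sum_w)
    qed
    show "AE x in M. 1 \<le> \<bar>x\<bar>"
      unfolding M_def by (subst AE_distr_iff) (auto simp: X_def)
  qed (simp_all add: M_def \<open>c > 0\<close>)
qed

theorem theorem7:
  fixes \<epsilon> :: real
  assumes "\<epsilon> > 0"
  shows "(SUP M\<in>{M. admissible_dist M}.
            limsup (\<lambda>n. ereal (Delta n M / (SUP z\<in>{0<..\<epsilon>}. z * Lind n M z)))) = \<infinity>"
proof (rule ereal_top)
  fix b :: real
  obtain c where c: "c > 0" "\<And>M A. admissible_dist M \<Longrightarrow> integrable M (\<lambda>x. \<bar>x\<bar> ^ 3) \<Longrightarrow>
     AE x in M. 1 \<le> \<bar>x\<bar> \<Longrightarrow> A > 0 \<Longrightarrow>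
     (\<And>t. t > 0 \<Longrightarrow> t * (LINT x|M. x\<^sup>2 * indicator {x. \<bar>x\<bar> \<ge> t} x) \<le> A) \<Longrightarrow>
     ereal (c * (LINT x|M. x ^ 3) / A)
       \<le> limsup (\<lambda>n. ereal (Delta n M / (SUP z\<in>{0<..\<epsilon>}. z * Lind n M z)))"
    using limsup_ratio_ge assms by blast
  \<comment> \<open>The 4 collects two factors 2: the third moment is at least
    \<open>d * real N / 2\<close>, and the weak third moment is at most
    \<open>2 * d\<close>.\<close>
  obtain N0 :: nat where N0: "b * 4 / c < real N0"
    using reals_Archimedean2 by blast
  \<comment> \<open>The maximum with 1 keeps the mixture nonempty.\<close>
  define N where "N = max 1 N0"
  have "b * 4 / c \<le> real N"
    using N0 by (simp add: N_def)
  then have N: "N \<ge> 1" "b \<le> c * real N / 4"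
    using c(1) by (auto simp: N_def field_simps)
  obtain M :: "real measure" and d :: real where M: "prob_space M" "sets M = sets borel" "d > 0"
    "\<And>f :: real \<Rightarrow> real. f \<in> borel_measurable borel \<Longrightarrow> integrable M f"
    and int: "\<And>f. f \<in> borel_measurable borel \<Longrightarrow>
       (LINT x|M. f x) = (\<Sum>k=1..N. d / (4 ^ k * (2 ^ k + 1)) * (f (2 ^ k) + 2 ^ k * f (- 1)))"
    and ge1: "AE x in M. 1 \<le> \<bar>x\<bar>"
    using dyadic_two_point_mixture[OF N(1)] by blast
  have pow: "(2 ^ k)\<^sup>2 = (4 ^ k :: real)" for k
    by (simp add: power_mult[symmetric] mult.commute[of k] power_mult)
  have m2: "(LINT x|M. x\<^sup>2) > 0"
    using N(1) M(3) by (subst int) (auto intro!: sum_pos mult_pos_pos divide_pos_pos add_pos_pos)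
  \<comment> \<open>Pair \<open>k\<close> contributes \<open>d * (1 - 1 / 2 ^ k)\<close>, which is
    at least \<open>d / 2\<close> because \<open>k \<ge> 1\<close>.\<close>
  have m3: "(LINT x|M. x ^ 3) \<ge> d * real N / 2"
  proof -
    have "d * real N / 2 = (\<Sum>k=1..N. d / 2)"
      by simp
    also have "\<dots> \<le> (\<Sum>k=1..N. d / (4 ^ k * (2 ^ k + 1)) * ((2 ^ k) ^ 3 + 2 ^ k * (- 1) ^ 3))"
    proof (rule sum_mono)
      fix k assume k: "k \<in> {1..N}"
      define m :: real where "m = 2 ^ k"
      have m: "m \<ge> 2"
        using k power_increasing[of 1 k "2 :: real"] by (simp add: m_def)
      have "d / 2 \<le> d * ((m - 1) / m)"
        using m M(3) by (simp add: field_simps)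
      also have "\<dots> = d / (m\<^sup>2 * (m + 1)) * (m ^ 3 + m * (- 1) ^ 3)"
        using m by (simp add: divide_simps) (simp add: algebra_simps power2_eq_square power3_eq_cube)
      finally show "d / 2 \<le> d / (4 ^ k * (2 ^ k + 1)) * ((2 ^ k) ^ 3 + 2 ^ k * (- 1) ^ 3)"
        by (simp only: m_def pow)
    qed
    finally show ?thesis
      by (subst int) auto
  qed
  have adm: "admissible_dist M"
    unfolding admissible_dist_def
  proof (intro conjI)
    show "(LINT x|M. x) = 0"
      by (subst int) auto
    show "integrable M (\<lambda>x. x)"
      by (rule M(4)) simp
    show "integrable M (\<lambda>x. x\<^sup>2)"
      by (rule M(4)) simp
  qed (rule M m2)+
  have tail: "t * (LINT x|M. x\<^sup>2 * indicator {x. \<bar>x\<bar> \<ge> t} x) \<le> 2 * d" if "t > 0" for t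
  proof -
    \<comment> \<open>For \<open>t \<le> 1\<close> the atom \<open>-1\<close> counts as well, but
      pair \<open>k\<close> then contributes \<open>t * d / 2 ^ k\<close>, at most the summand for
      level 1. For \<open>t > 1\<close> only \<open>2 ^ k\<close> can count. Raising the level to
      \<open>s\<close> covers both cases by one dyadic sum.\<close>
    define s where "s = max t 1"
    have s: "s > 0" by (simp add: s_def)
    have "t * (LINT x|M. x\<^sup>2 * indicator {x. \<bar>x\<bar> \<ge> t} x)
        = (\<Sum>k=1..N. t * (d / (4 ^ k * (2 ^ k + 1)) *
            ((2 ^ k)\<^sup>2 * indicator {x. \<bar>x\<bar> \<ge> t} (2 ^ k) + 2 ^ k * ((- 1)\<^sup>2 * indicator {x. \<bar>x\<bar> \<ge> t} (- 1)))))"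
      by (subst int) (auto simp: sum_distrib_left)
    also have "\<dots> \<le> (\<Sum>k=1..N. d * (if s \<le> 2 ^ k then s / 2 ^ k else 0))"
    proof (rule sum_mono)
      fix k
      define m :: real where "m = 2 ^ k"
      have m: "m \<ge> 1" by (simp add: m_def)
      have "t * (d / (m\<^sup>2 * (m + 1)) *
          (m\<^sup>2 * indicator {x. \<bar>x\<bar> \<ge> t} m + m * ((- 1)\<^sup>2 * indicator {x. \<bar>x\<bar> \<ge> t} (- 1))))
          \<le> d * (if s \<le> m then s / m else 0)"
      proof (cases "t \<le> 1")
        case True
        have "t * (d / (m\<^sup>2 * (m + 1)) * (m\<^sup>2 + m)) = t * (d / m)"
          using m by (simp add: divide_simps) (simp add: algebra_simps power2_eq_square)
        also have "\<dots> \<le> 1 * (d / m)"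
          using True m M(3) by (intro mult_right_mono) auto
        finally show ?thesis
          using True m by (simp add: s_def max_def)
      next
        case False
        have "t * (d / (m\<^sup>2 * (m + 1)) * m\<^sup>2) = d * (t / (m + 1))"
          using m by simp
        also have "\<dots> \<le> d * (t / m)"
          using False m M(3) by (intro mult_left_mono divide_left_mono) auto
        finally show ?thesis
          using False m by (simp add: s_def max_def indicator_def)
      qed
      then show "t * (d / (4 ^ k * (2 ^ k + 1)) *
            ((2 ^ k)\<^sup>2 * indicator {x. \<bar>x\<bar> \<ge> t} (2 ^ k) + 2 ^ k * ((- 1)\<^sup>2 * indicator {x. \<bar>x\<bar> \<ge> t} (- 1))))
          \<le> d * (if s \<le> 2 ^ k then s / 2 ^ k else 0)"
        by (simp only: m_def pow)
    qed
    also have "\<dots> = d * (\<Sum>k=1..N. if s \<le> 2 ^ k then s / 2 ^ k else 0)"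
      by (simp add: sum_distrib_left)
    also have "\<dots> \<le> d * 2"
    proof (rule mult_left_mono)
      have "(if s \<le> 2 ^ N then 2 - s / 2 ^ N else 0) \<le> 2"
        using s by auto
      then show "(\<Sum>k=1..N. if s \<le> 2 ^ k then s / 2 ^ k else 0) \<le> 2"
        using sum_dyadic_tail_le[OF s, of N] by linarith
    qed (use M(3) in auto)
    finally show ?thesis by simp
  qed
  have "ereal b \<le> ereal (c * (LINT x|M. x ^ 3) / (2 * d))"
  proof -
    \<comment> \<open>The normalizing constant \<open>d\<close> cancels between the third moment and
      its weak form, leaving growth linear in \<open>N\<close>.\<close>
    have "c * real N / 4 = c * (d * real N / 2) / (2 * d)"
      using M(3) by simp
    also have "\<dots> \<le> c * (LINT x|M. x ^ 3) / (2 * d)"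
      using m3 c(1) M(3) by (intro divide_right_mono mult_left_mono) auto
    finally have "c * real N / 4 \<le> c * (LINT x|M. x ^ 3) / (2 * d)" .
    with N(2) show ?thesis
      unfolding ereal_less_eq by linarith
  qed
  also have "\<dots> \<le> limsup (\<lambda>n. ereal (Delta n M / (SUP z\<in>{0<..\<epsilon>}. z * Lind n M z)))"
    using M(3) tail by (intro c(2) adm M(4) ge1) auto
  also have "\<dots> \<le> (SUP M\<in>{M. admissible_dist M}.
            limsup (\<lambda>n. ereal (Delta n M / (SUP z\<in>{0<..\<epsilon>}. z * Lind n M z))))"
    using adm by (intro SUP_upper) auto
  finally show "ereal b \<le> (SUP M\<in>{M. admissible_dist M}.
            limsup (\<lambda>n. ereal (Delta n M / (SUP z\<in>{0<..\<epsilon>}. z * Lind n M z))))" .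
qed

end
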